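(* Assume $f'''(1)\ne0$. Consider the equal-weight three-point input family: $\Omega_0=\{1,2,3\}$ with counting measure, $p=(1/3,1/3,1/3)$, $\mathbf w=(1,1,1)$, $\alpha\in\mathbb R\setminus\{0\}$, $h_1=\alpha(2,-1,-1)$, $h_2=\alpha(-1,2,-1)$, $h_3=\alpha(-1,-1,2)$, and $p_i^\varepsilon=p+\varepsilon h_i$ (so the leaf second-order coefficients are $B_i=0$). For every scalar calibration $g$, the second-order rotation coefficient $B^{(12)3}-B^{1(23)}$ equals \[ -\frac{3\alpha^2}{4}\,\frac{f'''(1)}{f''(1)}\,(1,0,-1). \] In particular, scalar weight calibration alone does not make the second-order root coefficient independent of the aggregation tree on this input family.
   Context: $f:(0,\infty)\to\mathbb R$ is convex and $C^3$ in a neighborhood of $1$, with $f(1)=f'(1)=0$, $f''(1)>0$; $A_2=f''(1)/2$, $A_3=f'''(1)/6$. For $a,b>0$ and functions $u,v$ on $\Omega_0$ with $\Delta=v-u$, $J=\sum_x\Delta(x)^2p(x)>0$, $L_3=\sum_x\Delta(x)^3p(x)$, $t_0(a,b)=\frac{\sqrt b}{\sqrt a+\sqrt b}$, put \[ \tau(a,b;u,v)=\frac{A_3L_3\{at_0^3+b(1-t_0)^3\}}{2A_2J\{at_0+b(1-t_0)\}},\qquad t_0=t_0(a,b). \] A scalar calibration is given by a positive function $g$ on $(0,\infty)$: it assigns each leaf the positive transformed mass $G_i=g(w_i)$, propagates masses additively ($G_{AB}=G_A+G_B$), and at a merge of blocks $A$ (left) and $B$ (right) uses endpoint balancing weights $a,b$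 proportional to $G_A^2,G_B^2$ (i.e. $a=\kappa G_A^2$, $b=\kappa G_B^2$ for some $\kappa>0$). The associated coefficients are defined recursively. At leaf $i$: $H_i=h_i$ and second-order coefficient $B_i=0$. At a merge of blocks $A$ (left) and $B$ (right), with endpoint balancing weights $a=\kappa G_A^2$, $b=\kappa G_B^2$ for some $\kappa>0$ and $t_0=t_0(a,b)$, \[ H_{AB}=(1-t_0)H_A+t_0H_B,\qquad B_{AB}=(1-t_0)B_A+t_0B_B+\tau(a,b;H_A/p,H_B/p)(H_B-H_A). \] $B^{(12)3}$ is the root second-order coefficient when leaves $1,2$ are merged first and the result is merged (as left block) with leaf $3$; $B^{1(23)}$ is the root second-order coefficient when leaves $2,3$ are merged first and leaf $1$ (as left block) is merged with the result. *)

theory Defs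
  imports "HOL-Analysis.Analysis"
begin

definition C3_near :: "(real \<Rightarrow> real) \<Rightarrow> real \<Rightarrow> bool" where
  "C3_near f c \<longleftrightarrow> (\<exists>U. open U \<and> c \<in> U \<and>
     (\<forall>k<3. \<forall>x\<in>U. (deriv ^^ k) f field_differentiable (at x)) \<and>
     continuous_on U ((deriv ^^ 3) f))"

definition A2 :: "(real \<Rightarrow> real) \<Rightarrow> real" where
  "A2 f = (deriv ^^ 2) f 1 / 2"

definition A3 :: "(real \<Rightarrow> real) \<Rightarrow> real" where
  "A3 f = (deriv ^^ 3) f 1 / 6"

definition t0 :: "real \<Rightarrow> real \<Rightarrow> real" where
  "t0 a b = sqrt b / (sqrt a + sqrt b)"

text \<open>The finite space \<open>\<Omega>\<^sub>0\<close> with counting measure is the index type \<open>'x\<close>.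
  The value of \<open>tau\<close> is only meaningful when \<open>J > 0\<close>, that is, when \<open>u\<close> and \<open>v\<close>
  differ at a point of positive mass.\<close>

definition tau :: "(real \<Rightarrow> real) \<Rightarrow> real ^ 'x \<Rightarrow> real \<Rightarrow> real \<Rightarrow> real ^ 'x \<Rightarrow> real ^ 'x \<Rightarrow> real" where
  "tau f p a b u v =
    (let J = (\<Sum>x\<in>UNIV. (v $ x - u $ x) ^ 2 * p $ x);
         L3 = (\<Sum>x\<in>UNIV. (v $ x - u $ x) ^ 3 * p $ x);
         t = t0 a b
     in A3 f * L3 * (a * t ^ 3 + b * (1 - t) ^ 3) / (2 * A2 f * J * (a * t + b * (1 - t))))"

definition ratio :: "real ^ 'x \<Rightarrow> real ^ 'x \<Rightarrow> real ^ 'x" where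
  "ratio H p = (\<chi> x. H $ x / p $ x)"

datatype 'i tree = Leaf 'i | Merge "'i tree" "'i tree"

fun leaves :: "'i tree \<Rightarrow> 'i list" where
  "leaves (Leaf i) = [i]"
| "leaves (Merge A B) = leaves A @ leaves B"

definition scalar_calibration :: "(real \<Rightarrow> real) \<Rightarrow> bool" where
  "scalar_calibration g \<longleftrightarrow> (\<forall>x>0. g x > 0)"

fun mass :: "(real \<Rightarrow> real) \<Rightarrow> ('i \<Rightarrow> real) \<Rightarrow> 'i tree \<Rightarrow> real" where
  "mass g w (Leaf i) = g (w i)"
| "mass g w (Merge A B) = mass g w A + mass g w B"

text \<open>The proportionality constant of the endpoint weights may be a different one at every
  merge: \<open>\<kappa> A B\<close> is the constant used when the blocks \<open>A\<close> (left) and \<open>B\<close> (right) are merged.\<close>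

type_synonym 'i scaling = "'i tree \<Rightarrow> 'i tree \<Rightarrow> real"

definition positive_scaling :: "'i scaling \<Rightarrow> bool" where
  "positive_scaling \<kappa> \<longleftrightarrow> (\<forall>A B. \<kappa> A B > 0)"

definition left_weight :: "(real \<Rightarrow> real) \<Rightarrow> 'i scaling \<Rightarrow> ('i \<Rightarrow> real) \<Rightarrow> 'i tree \<Rightarrow> 'i tree \<Rightarrow> real" where
  "left_weight g \<kappa> w A B = \<kappa> A B * (mass g w A) ^ 2"

definition right_weight :: "(real \<Rightarrow> real) \<Rightarrow> 'i scaling \<Rightarrow> ('i \<Rightarrow> real) \<Rightarrow> 'i tree \<Rightarrow> 'i tree \<Rightarrow> real" where
  "right_weight g \<kappa> w A B = \<kappa> A B * (mass g w B) ^ 2"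

fun first_coeff ::
  "(real \<Rightarrow> real) \<Rightarrow> 'i scaling \<Rightarrow> ('i \<Rightarrow> real) \<Rightarrow> ('i \<Rightarrow> real ^ 'x) \<Rightarrow> 'i tree \<Rightarrow> real ^ 'x" where
  "first_coeff g \<kappa> w h (Leaf i) = h i"
| "first_coeff g \<kappa> w h (Merge A B) =
    (let t = t0 (left_weight g \<kappa> w A B) (right_weight g \<kappa> w A B)
     in (1 - t) *\<^sub>R first_coeff g \<kappa> w h A + t *\<^sub>R first_coeff g \<kappa> w h B)"

fun second_coeff ::
  "(real \<Rightarrow> real) \<Rightarrow> real ^ 'x \<Rightarrow> (real \<Rightarrow> real) \<Rightarrow> 'i scaling \<Rightarrow> ('i \<Rightarrow> real) \<Rightarrow>
    ('i \<Rightarrow> real ^ 'x) \<Rightarrow> 'i tree \<Rightarrow> real ^ 'x" where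
  "second_coeff f p g \<kappa> w h (Leaf i) = 0"
| "second_coeff f p g \<kappa> w h (Merge A B) =
    (let a = left_weight g \<kappa> w A B;
         b = right_weight g \<kappa> w A B;
         t = t0 a b;
         HA = first_coeff g \<kappa> w h A;
         HB = first_coeff g \<kappa> w h B
     in (1 - t) *\<^sub>R second_coeff f p g \<kappa> w h A + t *\<^sub>R second_coeff f p g \<kappa> w h B
        + tau f p a b (ratio HA p) (ratio HB p) *\<^sub>R (HB - HA))"

definition input_family :: "real ^ 'x \<Rightarrow> ('i \<Rightarrow> real ^ 'x) \<Rightarrow> real \<Rightarrow> 'i \<Rightarrow> real ^ 'x" where
  "input_family p h \<epsilon> i = p + \<epsilon> *\<^sub>R h i"

text \<open>The leaf values of the recursions are the first- and second-order coefficients of the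
  input family, which enters the recursions through \<open>h\<close> only.\<close>

lemma input_family_leaf_coeffs:
  "input_family p h \<epsilon> i = p + \<epsilon> *\<^sub>R first_coeff g \<kappa> w h (Leaf i)
     + \<epsilon>\<^sup>2 *\<^sub>R second_coeff f p g \<kappa> w h (Leaf i)"
  by (simp add: input_family_def)

text \<open>The trees compared carry the same leaves in the same left-to-right order, so they differ
  only in bracketing.\<close>

definition tree_independent ::
  "(real \<Rightarrow> real) \<Rightarrow> real ^ 'x \<Rightarrow> (real \<Rightarrow> real) \<Rightarrow> 'i scaling \<Rightarrow> ('i \<Rightarrow> real) \<Rightarrow>
    ('i \<Rightarrow> real ^ 'x) \<Rightarrow> 'i list \<Rightarrow> bool" where
  "tree_independent f p g \<kappa> w h is \<longleftrightarrow>
    (\<forall>S T. leaves S = is \<and> leaves T = is \<longrightarrow>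
       second_coeff f p g \<kappa> w h S = second_coeff f p g \<kappa> w h T)"

end

theory Submission
  imports Defs
begin

text \<open>With endpoint weights proportional to squared masses, \<open>t\<^sub>0\<close> is the mass share of the
  right block and the weight factor of \<open>\<tau>\<close> collapses to \<open>t\<^sub>0 (1 - t\<^sub>0)\<close>, so only mass
  ratios enter. Equal weights give equal leaf masses, whatever \<open>g\<close> is; hence the leaf merges
  have \<open>t\<^sub>0 = 1/2\<close>, the root merges have \<open>t\<^sub>0 = 1/3\<close> and \<open>t\<^sub>0 = 2/3\<close>, and calibration
  cannot influence the result. The leaf merges contribute nothing because there \<open>L\<^sub>3 = 0\<close> by
  antisymmetry; at the two roots \<open>L\<^sub>3\<close> has opposite signs.\<close>

lemma t0_proportional_squares:
  assumes "k > 0" "x > 0" "y > 0"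
  shows "t0 (k * x\<^sup>2) (k * y\<^sup>2) = y / (x + y)"
proof -
  have "t0 (k * x\<^sup>2) (k * y\<^sup>2) = (sqrt k * y) / (sqrt k * (x + y))"
    using assms by (simp add: t0_def real_sqrt_mult distrib_left)
  then show ?thesis
    using assms by simp
qed

text \<open>With s = x + y, the factor x + y arising in each sum cancels one power of s: the
  denominator becomes k x y and the numerator k (x y)^2 / s^2.\<close>

lemma weight_factor_proportional_squares:
  fixes k x y :: real
  assumes "k > 0" "x > 0" "y > 0"
  defines "t \<equiv> y / (x + y)"
  shows "(k * x\<^sup>2 * t ^ 3 + k * y\<^sup>2 * (1 - t) ^ 3) / (k * x\<^sup>2 * t + k * y\<^sup>2 * (1 - t))
    = t * (1 - t)"
proof -
  define s where "s = x + y"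
  have s: "s > 0" and t: "t = y / s" and t': "1 - t = x / s"
    using assms by (auto simp: s_def t_def field_simps)
  have "k * x\<^sup>2 * t + k * y\<^sup>2 * (1 - t) = k * x * y"
  proof -
    have "k * x\<^sup>2 * t + k * y\<^sup>2 * (1 - t) = k * x * y * (x + y) / s"
      unfolding t' unfolding t by (simp add: algebra_simps power2_eq_square add_divide_distrib)
    then show ?thesis using s by (simp add: s_def)
  qed
  moreover have "k * x\<^sup>2 * t ^ 3 + k * y\<^sup>2 * (1 - t) ^ 3 = k * x * y * (t * (1 - t))"
  proof -
    have "k * x\<^sup>2 * t ^ 3 + k * y\<^sup>2 * (1 - t) ^ 3 = k * (x * y)\<^sup>2 * (x + y) / s ^ 3"
      unfolding t' unfolding t
      by (simp add: algebra_simps power2_eq_square power3_eq_cube add_divide_distrib)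
    also have "\<dots> = k * (x * y)\<^sup>2 / s\<^sup>2"
      using s by (simp add: s_def power2_eq_square power3_eq_cube)
    finally show ?thesis
      unfolding t' unfolding t by (simp add: power2_eq_square algebra_simps)
  qed
  ultimately show ?thesis
    using assms by simp
qed

lemma tau_proportional_squares:
  assumes "k > 0" "x > 0" "y > 0"
  defines "t \<equiv> y / (x + y)"
  shows "tau f p (k * x\<^sup>2) (k * y\<^sup>2) u v =
    A3 f / (2 * A2 f) * (t * (1 - t)) *
      ((\<Sum>i\<in>UNIV. (v $ i - u $ i) ^ 3 * p $ i) / (\<Sum>i\<in>UNIV. (v $ i - u $ i)\<^sup>2 * p $ i))"
  \<comment> \<open>In \<open>tau\<close> the two weight sums are spread over one large fraction, so
    their quotient is not a subterm there. Hence t (1 - t) on the right is expanded back into it;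
    both sides then agree up to rearranging factors.\<close>
  unfolding tau_def Let_def t0_proportional_squares[OF assms(1-3)]
    weight_factor_proportional_squares[OF assms(1-3), folded t_def, symmetric]
    t_def[symmetric]
  by (simp add: mult_ac)

text \<open>The share \<open>t\<close> is a variable tied down by an equation, so that a merge can
  be evaluated at a numeral such as 1/2 while \<open>g\<close> stays arbitrary.\<close>

lemma first_coeff_Merge:
  assumes "\<kappa> A B > 0" "mass g w A > 0" "mass g w B > 0"
    and "mass g w B / (mass g w A + mass g w B) = t"
  shows "first_coeff g \<kappa> w h (Merge A B) =
    (1 - t) *\<^sub>R first_coeff g \<kappa> w h A + t *\<^sub>R first_coeff g \<kappa> w h B"
  using t0_proportional_squares[OF assms(1-3)] assms(4)
  by (simp add: left_weight_def right_weight_def Let_def)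

text \<open>\<open>HA\<close> and \<open>HB\<close> are variables for the same reason as
  \<open>t\<close>: first coefficients already computed for the subtrees can be plugged in.\<close>

lemma second_coeff_Merge:
  assumes "\<kappa> A B > 0" "mass g w A > 0" "mass g w B > 0"
    and "mass g w B / (mass g w A + mass g w B) = t"
    and "first_coeff g \<kappa> w h A = HA" "first_coeff g \<kappa> w h B = HB"
  shows "second_coeff f p g \<kappa> w h (Merge A B) =
    (1 - t) *\<^sub>R second_coeff f p g \<kappa> w h A + t *\<^sub>R second_coeff f p g \<kappa> w h B +
    (A3 f / (2 * A2 f) * (t * (1 - t)) *
      ((\<Sum>i\<in>UNIV. (HB $ i / p $ i - HA $ i / p $ i) ^ 3 * p $ i) /
       (\<Sum>i\<in>UNIV. (HB $ i / p $ i - HA $ i / p $ i)\<^sup>2 * p $ i))) *\<^sub>R (HB - HA)"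
  using assms
  by (simp add: t0_proportional_squares tau_proportional_squares
      left_weight_def right_weight_def Let_def ratio_def)

theorem proposition15:
  fixes f :: "real \<Rightarrow> real" and \<alpha> :: real
    and p :: "real ^ 3" and w :: "nat \<Rightarrow> real" and h :: "nat \<Rightarrow> real ^ 3"
  assumes "convex_on {0<..} f"
    and "C3_near f 1"
    and "f 1 = 0"
    and "deriv f 1 = 0"
    and "(deriv ^^ 2) f 1 > 0"
    and "(deriv ^^ 3) f 1 \<noteq> 0"
    and "\<alpha> \<noteq> 0"
    and "p = vector [1/3, 1/3, 1/3]"
    and "w 1 = 1" and "w 2 = 1" and "w 3 = 1"
    and "h 1 = \<alpha> *\<^sub>R vector [2, -1, -1]"
    and "h 2 = \<alpha> *\<^sub>R vector [-1, 2, -1]"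
    and "h 3 = \<alpha> *\<^sub>R vector [-1, -1, 2]"
  shows "(\<forall>g \<kappa>. scalar_calibration g \<and> positive_scaling \<kappa> \<longrightarrow>
            second_coeff f p g \<kappa> w h (Merge (Merge (Leaf 1) (Leaf 2)) (Leaf 3))
            - second_coeff f p g \<kappa> w h (Merge (Leaf 1) (Merge (Leaf 2) (Leaf 3)))
            = (- (3 * \<alpha>\<^sup>2 / 4) * ((deriv ^^ 3) f 1 / (deriv ^^ 2) f 1)) *\<^sub>R vector [1, 0, -1])
       \<and> (\<forall>g \<kappa>. scalar_calibration g \<and> positive_scaling \<kappa> \<longrightarrow>
            \<not> tree_independent f p g \<kappa> w h [1, 2, 3])"
proof -
  \<comment> \<open>The derivatives of f enter only through \<open>A3 f / (2 * A2 f)\<close>, which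
    is r / 6.\<close>
  define r where "r = (deriv ^^ 3) f 1 / (deriv ^^ 2) f 1"
  have A2: "A2 f \<noteq> 0"
    using assms(5) by (simp add: A2_def)
  have A3: "A3 f = r * A2 f / 3"
    using assms(5) by (simp add: A3_def A2_def r_def)
  have "r \<noteq> 0"
    using assms(5,6) by (simp add: r_def)
  let ?S = "Merge (Merge (Leaf 1) (Leaf 2)) (Leaf 3) :: nat tree"
  let ?T = "Merge (Leaf 1) (Merge (Leaf 2) (Leaf 3)) :: nat tree"
  have difference: "second_coeff f p g \<kappa> w h ?S - second_coeff f p g \<kappa> w h ?T
      = (- (3 * \<alpha>\<^sup>2 / 4) * r) *\<^sub>R vector [1, 0, -1]"
    if g: "scalar_calibration g" and \<kappa>: "positive_scaling \<kappa>" for g \<kappa>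
  proof -
    have c: "g 1 > 0"
      using g by (simp add: scalar_calibration_def)
    have \<kappa>_pos: "\<kappa> A B > 0" for A B
      using \<kappa> by (simp add: positive_scaling_def)
    note coords = vec_eq_iff forall_3 sum_3 vector_3 assms(8,12-14)
    \<comment> \<open>Without \<open>One_nat_def\<close> the leaf index 1 is not turned into
      \<open>Suc 0\<close>, so the hypotheses on \<open>w 1\<close> and \<open>h 1\<close> still
      match.\<close>
    have H12: "first_coeff g \<kappa> w h (Merge (Leaf 1) (Leaf 2)) = \<alpha> *\<^sub>R vector [1/2, 1/2, -1]"
      using c by (subst first_coeff_Merge[where t = "1/2"])
        (simp_all add: \<kappa>_pos assms(9-11) coords del: first_coeff.simps(2) One_nat_def)
    have H23: "first_coeff g \<kappa> w h (Merge (Leaf 2) (Leaf 3)) = \<alpha> *\<^sub>R vector [-1, 1/2, 1/2]"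
      using c by (subst first_coeff_Merge[where t = "1/2"])
        (simp_all add: \<kappa>_pos assms(9-11) coords del: first_coeff.simps(2) One_nat_def)
    have B12: "second_coeff f p g \<kappa> w h (Merge (Leaf 1) (Leaf 2)) = 0"
      using c by (subst second_coeff_Merge[where t = "1/2", OF _ _ _ _ refl refl])
        (simp_all add: \<kappa>_pos assms(9-11) coords power3_eq_cube algebra_simps
          del: second_coeff.simps(2) One_nat_def)
    have B23: "second_coeff f p g \<kappa> w h (Merge (Leaf 2) (Leaf 3)) = 0"
      using c by (subst second_coeff_Merge[where t = "1/2", OF _ _ _ _ refl refl])
        (simp_all add: \<kappa>_pos assms(9-11) coords power3_eq_cube algebra_simps
          del: second_coeff.simps(2) One_nat_def)
    \<comment> \<open>Here t (1 - t) = 2/9, and the density difference \<alpha> (-9/2, -9/2, 9)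
      gives L3 / J = 9 \<alpha> / 2; times r / 6 this is \<alpha> r / 6. Since the simplifier
      replaces \<open>p\<close> by its value, \<open>B12\<close> is needed in that form too.\<close>
    have "second_coeff f p g \<kappa> w h ?S = (\<alpha> * r / 6) *\<^sub>R (h 3 - \<alpha> *\<^sub>R vector [1/2, 1/2, -1])"
      using c assms(7) A2 by (subst second_coeff_Merge[where t = "1/3", OF _ _ _ _ H12 refl])
        (simp_all add: \<kappa>_pos assms(9-11) B12[unfolded assms(8)] A3 coords power2_eq_square power3_eq_cube field_simps
          del: second_coeff.simps(2) One_nat_def)
    moreover
    \<comment> \<open>Now the density difference is \<alpha> (-9, 9/2, 9/2), so L3 / J changes sign
      while t (1 - t) is again 2/9.\<close>
    have "second_coeff f p g \<kappa> w h ?T = (- (\<alpha> * r / 6)) *\<^sub>R (\<alpha> *\<^sub>R vector [-1, 1/2, 1/2] - h 1)"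
      using c assms(7) A2 by (subst second_coeff_Merge[where t = "2/3", OF _ _ _ _ refl H23])
        (simp_all add: \<kappa>_pos assms(9-11) B23[unfolded assms(8)] A3 coords power2_eq_square power3_eq_cube field_simps
          del: second_coeff.simps(2) One_nat_def)
    \<comment> \<open>The difference is \<alpha>^2 r / 6 times (-3/2, -3/2, 3) + (-3, 3/2, 3/2) =
      (-9/2, 0, 9/2).\<close>
    ultimately show ?thesis
      by (simp add: coords power2_eq_square algebra_simps del: second_coeff.simps One_nat_def)
  qed
  moreover have "\<not> tree_independent f p g \<kappa> w h [1, 2, 3]"
    if "scalar_calibration g" "positive_scaling \<kappa>" for g \<kappa>
  proof
    assume "tree_independent f p g \<kappa> w h [1, 2, 3]"
    then have "second_coeff f p g \<kappa> w h ?S = second_coeff f p g \<kappa> w h ?T"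
      unfolding tree_independent_def by (metis append.simps leaves.simps)
    then have "(- (3 * \<alpha>\<^sup>2 / 4) * r) *\<^sub>R (vector [1, 0, -1] :: real ^ 3) = 0"
      using difference[OF that] by simp
    \<comment> \<open>The first coordinate, -(3 \<alpha>^2 / 4) r, is nonzero.\<close>
    then show False
      using \<open>r \<noteq> 0\<close> assms(7) by (simp add: vec_eq_iff forall_3 vector_3)
  qed
  ultimately show ?thesis
    unfolding r_def by blast
qed

end
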